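(* Let $T\ge100$, let $\mathcal{X}$ be an instance space, let $x_{1:T}=(x_1,\dots,x_T)$ be a sequence of distinct points of $\mathcal{X}$, and let $\mathcal{F}$ be any family of concept classes $\mathcal{C}\subseteq\{0,1\}^{\mathcal{X}}$ with the property that for every labeling function $f:\{x_1,\dots,x_T\}\to\{0,1\}$ there exist some $\mathcal{C}\in\mathcal{F}$ and some $c\in\mathcal{C}$ such that $c(x_t)=f(x_t)$ for all $t\in[T]$. Then any (possibly randomized) transductive online learning algorithm in the realizable setting that makes at most $T/20$ queries to the weak consistency oracle incurs an expected number of mistakes of at least $T/20$ in the worst case over $\mathcal{C}\in\mathcal{F}$ and $c\in\mathcal{C}$ on the instance sequence $x_{1:T}$.
   Context: Transductive online learning with oracle access (realizable setting). The family $\mathcal{F}$ and horizon $T$ are known to the learner. An oblivious adversary fixes an unknown $\mathcal{C}\in\mathcal{F}$, a target $c\in\mathcal{C}$ and a sequence $x_{1:T}\in\mathcal{X}^T$. The whole sequence $x_{1:T}$ is revealed to the learner at the start. The learner can access $\mathcal{C}$ only through an oracle, which it may query at any time. In round $t=1,\dots,T$ the learner picks a distribution on $\{0,1\}$ and predicts $\hat y_t$ drawn from it, then $y_t=c(x_t)$ is revealed; a mistake occurs if $\hat y_t\neq y_t$. The expectation is over the learner's randomness. Weak consistency oracle: given any finite sequence $S=(x_1,y_1),\dots,(x_n,y_n)$ in $\mathcal{X}\times\{0,1\}$, it returns "realizable" if some $c\in\mathcal{C}$ is consistent with $S$, and "not realizable" otherwise. *)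

theory Defs
  imports "HOL-Probability.Probability"
begin

text \<open>Instances are the elements of the type \<open>'x\<close>, labels are Booleans, a concept is a function
  \<open>'x \<Rightarrow> bool\<close>, a concept class a set of concepts and a family a set of concept classes.\<close>

definition weak_consistency_oracle :: "('x \<Rightarrow> bool) set \<Rightarrow> ('x \<times> bool) list \<Rightarrow> bool" where
  "weak_consistency_oracle C S \<longleftrightarrow> (\<exists>c\<in>C. \<forall>(u, b)\<in>set S. c u = b)"

text \<open>An online strategy is an interaction tree: at each point it either queries the oracle and
  continues depending on the answer, or ends the current round by choosing a distribution on the
  labels; it then continues depending on the drawn prediction and on the revealed label, in this
  order. A node may depend on everything observed on the way to it. Strategies have no access to
  the concept class or the target other than through these answers and labels.\<close>

datatype 'x strategy =
    Stop
  | Query "('x \<times> bool) list" "bool \<Rightarrow> 'x strategy"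
  | Predict "bool pmf" "bool \<Rightarrow> bool \<Rightarrow> 'x strategy"

primrec plays_rounds :: "'x strategy \<Rightarrow> nat \<Rightarrow> bool" where
  "plays_rounds Stop n \<longleftrightarrow> n = 0"
| "plays_rounds (Query S k) n \<longleftrightarrow> (\<forall>a. plays_rounds (k a) n)"
| "plays_rounds (Predict p k) n \<longleftrightarrow> n > 0 \<and> (\<forall>b y. plays_rounds (k b y) (n - 1))"

text \<open>Joint distribution of the numbers of queries and of mistakes when a strategy is run from
  round \<open>t\<close> on, against the oracle \<open>orc\<close> and the true labels \<open>y\<close>. The randomness is that of drawing
  the predictions.\<close>

primrec run :: "'x strategy \<Rightarrow> (('x \<times> bool) list \<Rightarrow> bool) \<Rightarrow> (nat \<Rightarrow> bool) \<Rightarrow> nat \<Rightarrow> (nat \<times> nat) pmf"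
where
  "run Stop orc y t = return_pmf (0, 0)"
| "run (Query S k) orc y t = map_pmf (\<lambda>(q, m). (Suc q, m)) (run (k (orc S)) orc y t)"
| "run (Predict p k) orc y t =
     bind_pmf p (\<lambda>b. map_pmf (\<lambda>(q, m). (q, (if b \<noteq> y t then Suc m else m)))
                        (run (k b (y t)) orc y (Suc t)))"

text \<open>Rounds are numbered from 1.\<close>

definition realizable_run ::
    "'x strategy \<Rightarrow> (nat \<Rightarrow> 'x) \<Rightarrow> ('x \<Rightarrow> bool) set \<Rightarrow> ('x \<Rightarrow> bool) \<Rightarrow> (nat \<times> nat) pmf" where
  "realizable_run A x C c = run A (weak_consistency_oracle C) (\<lambda>t. c (x t)) 1"

definition strategy_mistakes ::
    "'x strategy \<Rightarrow> (nat \<Rightarrow> 'x) \<Rightarrow> ('x \<Rightarrow> bool) set \<Rightarrow> ('x \<Rightarrow> bool) \<Rightarrow> real" where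
  "strategy_mistakes A x C c = measure_pmf.expectation (realizable_run A x C c) (\<lambda>(q, m). real m)"

text \<open>Besides drawing its predictions, a learner may use arbitrary internal randomness, for instance
  to choose its queries: it draws a seed from a probability space \<open>M\<close> and plays the strategy given
  by the seed. The measurability condition says that the expected number of mistakes is well defined
  for each possible choice of the adversary.\<close>

definition randomized_learner ::
    "nat \<Rightarrow> (nat \<Rightarrow> 'x) \<Rightarrow> ('x \<Rightarrow> bool) set set \<Rightarrow> 'w measure \<Rightarrow> ('w \<Rightarrow> 'x strategy) \<Rightarrow> bool" where
  "randomized_learner T x F M A \<longleftrightarrow>
     prob_space M \<and>
     (\<forall>w\<in>space M. plays_rounds (A w) T) \<and>
     (\<forall>C\<in>F. \<forall>c\<in>C. (\<lambda>w. strategy_mistakes (A w) x C c) \<in> borel_measurable M)"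

definition expected_mistakes ::
    "'w measure \<Rightarrow> ('w \<Rightarrow> 'x strategy) \<Rightarrow> (nat \<Rightarrow> 'x) \<Rightarrow> ('x \<Rightarrow> bool) set \<Rightarrow> ('x \<Rightarrow> bool) \<Rightarrow> real" where
  "expected_mistakes M A x C c = (\<integral>w. strategy_mistakes (A w) x C c \<partial>M)"

text \<open>The bound holds almost surely, for each possible choice of the adversary.\<close>

definition query_bounded ::
    "real \<Rightarrow> (nat \<Rightarrow> 'x) \<Rightarrow> ('x \<Rightarrow> bool) set set \<Rightarrow> 'w measure \<Rightarrow> ('w \<Rightarrow> 'x strategy) \<Rightarrow> bool" where
  "query_bounded B x F M A \<longleftrightarrow>
     (\<forall>C\<in>F. \<forall>c\<in>C. AE w in M. \<forall>(q, m)\<in>set_pmf (realizable_run (A w) x C c). real q \<le> B)"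

end

theory Submission
  imports Defs
begin

text \<open>The idea is to draw the labels uniformly at random. Each round then multiplies the expectation
  of \<open>z ^ mistakes\<close> by \<open>(1 + z) / 2\<close>, whatever the learner predicts. The oracle answers may depend on
  all labels, but a query with two possible answers at most doubles this expectation, so the
  expectation of \<open>(1/2) ^ queries * z ^ mistakes\<close> is at most \<open>((1 + z) / 2) ^ T\<close>. For \<open>z = 1/2\<close>, a
  tangent-line bound for the exponential function turns this into a lower bound on the average
  number of mistakes, for almost every seed.\<close>

lemma sum_Pow_insert:
  assumes "finite A" "a \<notin> A"
  shows "sum f (Pow (insert a A)) = (\<Sum>Y\<in>Pow A. f Y) + (\<Sum>Y\<in>Pow A. f (insert a Y))"
proof -
  have "inj_on (insert a) (Pow A)" "Pow A \<inter> insert a ` Pow A = {}"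
    using assms(2) by (auto simp: inj_on_def)
  then show ?thesis
    using assms(1) by (simp add: Pow_insert sum.union_disjoint sum.reindex)
qed

text \<open>Only the Boolean predictions are random in a run. Finite support makes every real
  function of its outcome integrable.\<close>

lemma finite_set_pmf_run: "finite (set_pmf (run s orc y t))"
proof (induction s arbitrary: t)
  case (Predict p k)
  have "finite (set_pmf (run (k b (y t)) orc y (Suc t)))" for b
    by (rule Predict.IH) auto
  then show ?case by simp
qed auto

text \<open>Gives a bound uniform in the seed, hence integrability of the expected mistakes over the
  seeds.\<close>

lemma mistakes_le_rounds:
  assumes "plays_rounds s n" "(q, m) \<in> set_pmf (run s orc y t)"
  shows "m \<le> n"
  using assms
proof (induction s arbitrary: n t q m)
  case (Predict p k)
  then obtain b m' where "(q, m') \<in> set_pmf (run (k b (y t)) orc y (Suc t))" "m \<le> Suc m'"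
    by (fastforce split: if_splits)
  moreover have "plays_rounds (k b (y t)) (n - 1)" "n > 0"
    using Predict.prems by auto
  ultimately show ?case
    using Predict.IH[of "k b" "k b (y t)" "n - 1" q m' "Suc t"] by fastforce
qed fastforce+

text \<open>The joint generating function of queries and mistakes, with the query variable set to
  \<open>1/2\<close>: this discount pays for summing over both answers to a query.\<close>

abbreviation weight :: "real \<Rightarrow> (nat \<times> nat) pmf \<Rightarrow> real" where
  "weight z r \<equiv> measure_pmf.expectation r (\<lambda>(q, m). (1/2) ^ q * z ^ m)"

lemma weight_nonneg: "z \<ge> 0 \<Longrightarrow> weight z r \<ge> 0"
  by (intro integral_nonneg_AE) auto

lemma weight_Query:
  "weight z (run (Query S k) orc y t) = weight z (run (k (orc S)) orc y t) / 2"
proof -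
  have "weight z (run (Query S k) orc y t) =
      measure_pmf.expectation (run (k (orc S)) orc y t) (\<lambda>r. (case r of (q, m) \<Rightarrow> (1/2) ^ q * z ^ m) / 2)"
    unfolding run.simps integral_map_pmf by (intro Bochner_Integration.integral_cong) auto
  then show ?thesis by simp
qed

lemma weight_Predict:
  "weight z (run (Predict p k) orc y t) =
    (\<Sum>b\<in>UNIV. pmf p b * ((if b \<noteq> y t then z else 1) * weight z (run (k b (y t)) orc y (Suc t))))"
proof -
  have step: "measure_pmf.expectation r (\<lambda>(q, m). (1/2) ^ q * z ^ (if b \<noteq> y t then Suc m else m)) =
      (if b \<noteq> y t then z else 1) * weight z r" for b r
    unfolding integral_mult_right_zero[symmetric]
    by (intro Bochner_Integration.integral_cong) auto
  show ?thesis
    unfolding run.simps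
    by (subst pmf_expectation_bind[where A = UNIV])
       (insert step, simp_all add: finite_set_pmf_run case_prod_unfold)
qed

text \<open>Both the oracle and the labels are indexed by the set \<open>Y\<close> of rounds labelled true; the labels
  outside the remaining rounds are left free so that the induction can peel off the first round.\<close>

lemma sum_weight_run_le:
  assumes "plays_rounds s n" "z \<ge> 0"
    and "\<And>Y i. Y \<subseteq> {t..<t + n} \<Longrightarrow> i \<in> {t..<t + n} \<Longrightarrow> y Y i \<longleftrightarrow> i \<in> Y"
  shows "(\<Sum>Y\<in>Pow {t..<t + n}. weight z (run s (orc Y) (y Y) t)) \<le> (1 + z) ^ n"
  using assms
proof (induction s arbitrary: n t y orc)
  case Stop
  then show ?case by simp
next
  case (Query S k)
  \<comment> \<open>Each answer \<open>a\<close> is followed for all \<open>Y\<close>, also where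
    the oracle answers otherwise. By nonnegativity the actual branch is at most the sum of both, and
    the factor \<open>1/2\<close> turns that sum into an average.\<close>
  have *: "(\<Sum>Y\<in>Pow {t..<t + n}. weight z (run (k a) (orc Y) (y Y) t)) \<le> (1 + z) ^ n" for a
    using Query.prems by (intro Query.IH) auto
  have "(\<Sum>Y\<in>Pow {t..<t + n}. weight z (run (Query S k) (orc Y) (y Y) t))
      \<le> (\<Sum>Y\<in>Pow {t..<t + n}. (weight z (run (k True) (orc Y) (y Y) t)
          + weight z (run (k False) (orc Y) (y Y) t)) / 2)"
  proof (intro sum_mono)
    fix Y
    show "weight z (run (Query S k) (orc Y) (y Y) t) \<le> (weight z (run (k True) (orc Y) (y Y) t)
          + weight z (run (k False) (orc Y) (y Y) t)) / 2"
      unfolding weight_Query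
      using weight_nonneg[OF \<open>z \<ge> 0\<close>, of "run (k True) (orc Y) (y Y) t"]
        weight_nonneg[OF \<open>z \<ge> 0\<close>, of "run (k False) (orc Y) (y Y) t"]
      by (cases "orc Y S") simp_all
  qed
  also have "\<dots> \<le> (1 + z) ^ n"
    using *[of True] *[of False] by (simp add: sum.distrib sum_divide_distrib[symmetric])
  finally show ?case .
next
  case (Predict p k)
  obtain n' where n: "n = Suc n'"
    using Predict.prems(1) by (cases n) auto
  define R where "R = {Suc t..<Suc t + n'}"
  have split: "{t..<t + n} = insert t R" "t \<notin> R" "finite R"
    by (auto simp: R_def n)
  have yt: "y Y t \<longleftrightarrow> t \<in> Y" if "Y \<subseteq> insert t R" for Y
    using Predict.prems(3)[of Y t] that unfolding split(1) by auto
  \<comment> \<open>\<open>g\<close> fixes the label of round \<open>t\<close>: \<open>id\<close>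
    makes it false, \<open>insert t\<close> makes it true. Reindexing oracle and labels by
    \<open>g\<close> leaves a sum over the later rounds only.\<close>
  have IH: "(\<Sum>Y\<in>Pow R. weight z (run (k b v) (orc (g Y)) (y (g Y)) (Suc t))) \<le> (1 + z) ^ n'"
    if g: "g = id \<or> g = insert t" for b v g
    unfolding R_def
  proof (rule Predict.IH[of "k b" "k b v" n' "Suc t" "\<lambda>Y. y (g Y)" "\<lambda>Y. orc (g Y)"])
    show "plays_rounds (k b v) n'" using Predict.prems(1) n by simp
    show "y (g Y) i \<longleftrightarrow> i \<in> Y" if "Y \<subseteq> {Suc t..<Suc t + n'}" "i \<in> {Suc t..<Suc t + n'}" for Y i
    proof -
      have "g Y \<subseteq> {t..<t + n}" "i \<in> {t..<t + n}" "i \<noteq> t"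
        using that g by (auto simp: n)
      then show ?thesis
        using Predict.prems(3)[of "g Y" i] g by auto
    qed
  qed (use \<open>z \<ge> 0\<close> in auto)
  \<comment> \<open>On each half the revealed label is the constant \<open>v\<close>, so the
    continuation \<open>k b v\<close> is the same for all \<open>Y\<close> and the sum over
    \<open>Y\<close> can move inside the sum over predictions.\<close>
  have branch: "(\<Sum>Y\<in>Pow R. weight z (run (Predict p k) (orc (g Y)) (y (g Y)) t))
      \<le> (\<Sum>b\<in>UNIV. pmf p b * ((if b \<noteq> v then z else 1) * (1 + z) ^ n'))"
    if g: "g = id \<and> v = False \<or> g = insert t \<and> v = True" for g v
  proof -
    have "y (g Y) t = v" if "Y \<in> Pow R" for Y
    proof -
      have "g Y \<subseteq> insert t R" "t \<in> g Y \<longleftrightarrow> v"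
        using that g split(2) by auto
      then show ?thesis using yt by blast
    qed
    then have "(\<Sum>Y\<in>Pow R. weight z (run (Predict p k) (orc (g Y)) (y (g Y)) t)) =
        (\<Sum>Y\<in>Pow R. \<Sum>b\<in>UNIV. pmf p b * ((if b \<noteq> v then z else 1) *
            weight z (run (k b v) (orc (g Y)) (y (g Y)) (Suc t))))"
      by (intro sum.cong refl) (simp add: weight_Predict del: run.simps)
    also have "\<dots> = (\<Sum>b\<in>UNIV. pmf p b * ((if b \<noteq> v then z else 1) *
            (\<Sum>Y\<in>Pow R. weight z (run (k b v) (orc (g Y)) (y (g Y)) (Suc t)))))"
      by (subst sum.swap) (simp add: sum_distrib_left)
    also have "\<dots> \<le> (\<Sum>b\<in>UNIV. pmf p b * ((if b \<noteq> v then z else 1) * (1 + z) ^ n'))"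
      using g \<open>z \<ge> 0\<close> by (intro sum_mono mult_left_mono IH) auto
    finally show ?thesis .
  qed
  have "(\<Sum>b\<in>UNIV. pmf p b) = 1"
    by (rule sum_pmf_eq_1) auto
  then have p: "pmf p True = 1 - pmf p False"
    by (simp add: UNIV_bool)
  have "(\<Sum>Y\<in>Pow {t..<t + n}. weight z (run (Predict p k) (orc Y) (y Y) t))
      \<le> (\<Sum>b\<in>UNIV. pmf p b * ((if b \<noteq> False then z else 1) * (1 + z) ^ n'))
        + (\<Sum>b\<in>UNIV. pmf p b * ((if b \<noteq> True then z else 1) * (1 + z) ^ n'))"
    unfolding split(1) sum_Pow_insert[OF split(3,2)]
    using branch[of id False] branch[of "insert t" True] by simp
  \<comment> \<open>Each prediction is right for one label of round \<open>t\<close> and wrong for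
    the other, so its factors add up to \<open>1 + z\<close> whatever \<open>p\<close> is.\<close>
  also have "\<dots> = (1 + z) ^ n"
    by (simp add: UNIV_bool n p algebra_simps)
  finally show ?case .
qed

text \<open>With \<open>z = 1/2\<close> the scaled weight is \<open>2 powr u\<close> for
  \<open>u = 2 * B - q - m\<close>. Its tangent at \<open>u = 0\<close> bounds \<open>m\<close> from
  below by \<open>2 * B - q\<close> plus the last term, and \<open>q \<le> B\<close> does the
  rest.\<close>

lemma mistakes_tangent_bound:
  assumes "real q \<le> B"
  shows "real m \<ge> B + (1 - 2 powr (2 * B) * ((1/2) ^ q * (1/2) ^ m)) / ln 2"
proof -
  define u where "u = 2 * B - real q - real m"
  have "2 powr (2 * B) * ((1/2) ^ q * (1/2) ^ m) = 2 powr u"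
    by (simp add: u_def powr_diff powr_realpow power_divide)
  moreover have "2 powr u \<ge> 1 + u * ln 2"
    by (simp add: powr_def)
  ultimately have "(1 - 2 powr (2 * B) * ((1/2) ^ q * (1/2) ^ m)) / ln 2 \<le> - u"
    by (simp add: divide_simps)
  then show ?thesis
    using assms by (simp add: u_def)
qed

text \<open>Rests on \<open>2 \<le> (4/3) ^ 10\<close>. The exponent is the sum of the two
  thresholds \<open>T / 20\<close>, for queries and for mistakes.\<close>

lemma powr_tenth_le: "2 powr (real T / 10) * (3/2) ^ T \<le> (2::real) ^ T"
proof -
  have "(2::real) powr (1/10) \<le> ((4/3) ^ 10) powr (1/10)"
    by (intro powr_mono2) (auto simp: power_divide)
  also have "((4/3::real) ^ 10) powr (1/10) = 4/3"
    by (simp only: powr_realpow[symmetric] powr_powr) simp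
  finally have "((2::real) powr (1/10)) ^ T \<le> (4/3) ^ T"
    by (intro power_mono) auto
  moreover have "((2::real) powr (1/10)) ^ T = 2 powr (real T / 10)"
    by (simp add: powr_realpow[symmetric] powr_powr)
  ultimately have "2 powr (real T / 10) * (3/2) ^ T \<le> (4/3) ^ T * (3/2::real) ^ T"
    by (intro mult_right_mono) auto
  also have "\<dots> = 2 ^ T"
    by (simp flip: power_mult_distrib)
  finally show ?thesis .
qed

theorem theorem4p3:
  fixes T :: nat
    and x :: "nat \<Rightarrow> 'x"
    and F :: "('x \<Rightarrow> bool) set set"
    and M :: "'w measure"
    and A :: "'w \<Rightarrow> 'x strategy"
  assumes "T \<ge> 100"
    and "inj_on x {1..T}"
    and "\<forall>f :: 'x \<Rightarrow> bool. \<exists>C\<in>F. \<exists>c\<in>C. \<forall>t\<in>{1..T}. c (x t) = f (x t)"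
    and "randomized_learner T x F M A"
    and "query_bounded (real T / 20) x F M A"
  shows "\<exists>C\<in>F. \<exists>c\<in>C. expected_mistakes M A x C c \<ge> real T / 20"
proof -
  define B where "B = real T / 20"
  \<comment> \<open>The sets of rounds labelled true; the interval has the form
    \<open>{t..<t + n}\<close> with first round \<open>t = 1\<close>.\<close>
  define P where "P = Pow {1..<1 + T}"
  have P: "finite P" "card P = 2 ^ T" "P \<noteq> {}"
    by (auto simp: P_def card_Pow)
  interpret prob_space M
    using assms(4) by (simp add: randomized_learner_def)
  have "\<exists>C c. C \<in> F \<and> c \<in> C \<and> (\<forall>t\<in>{1..T}. c (x t) \<longleftrightarrow> t \<in> Y)" if "Y \<in> P" for Y
  proof -
    obtain C c where "C \<in> F" "c \<in> C" and c: "\<forall>t\<in>{1..T}. c (x t) \<longleftrightarrow> x t \<in> x ` Y"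
      using assms(3)[rule_format, of "\<lambda>u. u \<in> x ` Y"] by blast
    moreover have "x t \<in> x ` Y \<longleftrightarrow> t \<in> Y" if "t \<in> {1..T}" for t
      using that \<open>Y \<in> P\<close> by (intro inj_on_image_mem_iff[OF assms(2)]) (auto simp: P_def)
    ultimately show ?thesis by blast
  qed
  \<comment> \<open>One class and target per labelling, chosen before the seed, as befits an
    oblivious adversary.\<close>
  then obtain C c where CF: "\<And>Y. Y \<in> P \<Longrightarrow> C Y \<in> F" and cC: "\<And>Y. Y \<in> P \<Longrightarrow> c Y \<in> C Y"
    and c: "\<And>Y t. Y \<in> P \<Longrightarrow> t \<in> {1..T} \<Longrightarrow> c Y (x t) \<longleftrightarrow> t \<in> Y"
    by metis
  define L where "L Y w = strategy_mistakes (A w) x (C Y) (c Y)" for Y w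
  define r where "r Y w = realizable_run (A w) x (C Y) (c Y)" for Y w
  have plays: "plays_rounds (A w) T" if "w \<in> space M" for w
    using assms(4) that by (simp add: randomized_learner_def)
  have fin_r: "finite (set_pmf (r Y w))" for Y w
    by (simp add: r_def realizable_run_def finite_set_pmf_run)
  have int: "integrable (measure_pmf (r Y w)) f" for Y w and f :: "nat \<times> nat \<Rightarrow> real"
    by (intro integrable_measure_pmf_finite fin_r)
  have L_bound: "L Y w \<in> {0..real T}" if "w \<in> space M" for Y w
  proof -
    have "0 \<le> L Y w"
      unfolding L_def strategy_mistakes_def by (intro integral_nonneg_AE) auto
    moreover have "L Y w \<le> real T"
      unfolding L_def strategy_mistakes_def r_def[symmetric]
    proof (intro measure_pmf.integral_le_const int AE_pmfI)
      fix qm assume "qm \<in> set_pmf (r Y w)"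
      then show "(case qm of (q, m) \<Rightarrow> real m) \<le> real T"
        using mistakes_le_rounds[OF plays[OF that]]
        by (cases qm) (auto simp: r_def realizable_run_def)
    qed
    ultimately show ?thesis by simp
  qed
  have integrable_L: "integrable M (L Y)" if "Y \<in> P" for Y
  proof (rule integrable_const_bound[where B = "real T"])
    show "AE w in M. norm (L Y w) \<le> real T"
      using L_bound by (intro AE_I2) auto
    show "L Y \<in> borel_measurable M"
      using assms(4) CF[OF that] cC[OF that] unfolding randomized_learner_def L_def by blast
  qed
  \<comment> \<open>Finitely many labellings, so almost every seed obeys the query bound for all of
    them at once.\<close>
  have "AE w in M. \<forall>Y\<in>P. \<forall>(q, m)\<in>set_pmf (r Y w). real q \<le> B"
    using assms(5) CF cC P(1) unfolding query_bounded_def r_def B_def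
    by (intro AE_finite_allI) auto
  then have "AE w in M. 2 ^ T * B \<le> (\<Sum>Y\<in>P. L Y w)"
  proof (rule AE_mp, intro AE_I2 impI)
    fix w assume w: "w \<in> space M" and q: "\<forall>Y\<in>P. \<forall>(q, m)\<in>set_pmf (r Y w). real q \<le> B"
    have "(\<Sum>Y\<in>P. weight (1/2) (r Y w)) \<le> (1 + 1/2) ^ T"
      unfolding P_def r_def realizable_run_def
      by (rule sum_weight_run_le[OF plays[OF w]]) (use c in \<open>auto simp: P_def\<close>)
    then have "2 powr (2 * B) * (\<Sum>Y\<in>P. weight (1/2) (r Y w)) \<le> 2 powr (2 * B) * (3/2) ^ T"
      by (intro mult_left_mono) auto
    also have "\<dots> \<le> 2 ^ T"
      using powr_tenth_le[of T] by (simp add: B_def)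
    finally have le: "0 \<le> (2 ^ T - 2 powr (2 * B) * (\<Sum>Y\<in>P. weight (1/2) (r Y w))) / ln 2"
      by simp
    \<comment> \<open>The tangent bound is affine in the weight, so it passes to expectations;
      summed over \<open>P\<close>, its correction term is nonnegative by \<open>le\<close>.\<close>
    have "B + (1 - 2 powr (2 * B) * weight (1/2) (r Y w)) / ln 2 \<le> L Y w" if "Y \<in> P" for Y
    proof -
      have "B + (1 - 2 powr (2 * B) * weight (1/2) (r Y w)) / ln 2 =
          measure_pmf.expectation (r Y w)
            (\<lambda>qm. B + (1 - 2 powr (2 * B) * (case qm of (q, m) \<Rightarrow> (1/2) ^ q * (1/2) ^ m)) / ln 2)"
        by (simp add: int)
      also have "\<dots> \<le> measure_pmf.expectation (r Y w) (\<lambda>(q, m). real m)"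
      proof (intro integral_mono_AE int AE_pmfI)
        fix qm assume "qm \<in> set_pmf (r Y w)"
        then show "B + (1 - 2 powr (2 * B) * (case qm of (q, m) \<Rightarrow> (1/2) ^ q * (1/2) ^ m)) / ln 2
            \<le> (case qm of (q, m) \<Rightarrow> real m)"
          using q that mistakes_tangent_bound by (cases qm) fastforce
      qed
      finally show ?thesis
        by (simp add: L_def strategy_mistakes_def r_def)
    qed
    then have "(\<Sum>Y\<in>P. B + (1 - 2 powr (2 * B) * weight (1/2) (r Y w)) / ln 2) \<le> (\<Sum>Y\<in>P. L Y w)"
      by (rule sum_mono)
    moreover have "(\<Sum>Y\<in>P. B + (1 - 2 powr (2 * B) * weight (1/2) (r Y w)) / ln 2) =
        2 ^ T * B + (2 ^ T - 2 powr (2 * B) * (\<Sum>Y\<in>P. weight (1/2) (r Y w))) / ln 2"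
      using P(2) by (simp add: sum.distrib sum_subtractf sum_distrib_left flip: sum_divide_distrib)
    ultimately show "2 ^ T * B \<le> (\<Sum>Y\<in>P. L Y w)"
      using le by linarith
  qed
  then have "2 ^ T * B \<le> (\<integral>w. (\<Sum>Y\<in>P. L Y w) \<partial>M)"
    by (intro integral_ge_const) (auto intro: integrable_L)
  also have "\<dots> = (\<Sum>Y\<in>P. expected_mistakes M A x (C Y) (c Y))"
    by (simp add: integrable_L) (simp add: expected_mistakes_def L_def)
  finally have sum_ge: "2 ^ T * B \<le> (\<Sum>Y\<in>P. expected_mistakes M A x (C Y) (c Y))" .
  \<comment> \<open>Some labelling does at least as badly as the average over all
    \<open>2 ^ T\<close>.\<close>
  have "\<exists>Y\<in>P. B \<le> expected_mistakes M A x (C Y) (c Y)"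
  proof (rule ccontr)
    assume "\<not> ?thesis"
    then have "(\<Sum>Y\<in>P. expected_mistakes M A x (C Y) (c Y)) < (\<Sum>Y\<in>P. B)"
      using P by (intro sum_strict_mono) (auto simp: not_le)
    then show False
      using sum_ge P(2) by simp
  qed
  then show ?thesis
    using CF cC unfolding B_def by blast
qed

end
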